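(* Let $a\in L^1(I)$ and $\lambda\in\mathbb{R}$. If the operator $L[\lambda]$ is nonresonant in $X_P$ and $r_4[\lambda](1)\neq0$, then for all $(t,s)\in I\times I$ $$G_D[\lambda](t,s)=G_P[\lambda](t,s)-\frac{r_4[\lambda](t)}{r_4[\lambda](1)}\,G_P[\lambda](1,s)$$ $$=G_P[\lambda](t,s)-\frac{G_P[\lambda](t,0)}{G_P[\lambda](1,0)}\,G_P[\lambda](1,s).$$
   Context: $I=[0,1]$, $a\in L^1(I)$ is real-valued, $\lambda\in\mathbb{R}$, and $L[\lambda]u(t)=u''(t)+(a(t)+\lambda)u(t)$. $W^{2,1}(I)=\{u\in C(I):u'\in AC(I)\}$, where $AC(I)$ is the set of absolutely continuous functions on $I$. $X_D=\{u\in W^{2,1}(I):u(0)=u(1)=0\}$ (Dirichlet) and $X_P=\{u\in W^{2,1}(I):u(0)=u(1),\,u'(0)=u'(1)\}$ (periodic). $L[\lambda]$ is nonresonant in $X$ if $u=0$ is the only $u\in X$ with $L[\lambda]u=0$ a.e. on $I$. In that case, for every $\sigma\in L^1(I)$ the problem $L[\lambda]u=\sigma$ a.e. on $I$, $u\in X$, has a unique solution, given by $u(t)=\int_0^1G(t,s)\sigma(s)\,ds$, where the continuous function $G:I\times I\to\mathbb{R}$ is the Green's function; it is denoted $G_D[\lambda]$ for $X=X_D$ (it exists under the hypotheses of the claim) and $G_P[\lambda]$ for $X=X_P$. $r_4[\lambda]$ is the unique solution of $L[\lambda]u=0$ a.e. on $I$, $u(0)-u(1)=0$, $u'(0)-u'(1)=1$.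 *)

theory Defs
  imports "HOL-Analysis.Analysis"
begin

text \<open>
  Functions on the unit interval are rendered as total functions on the reals of which only the
  values on \<open>{0..1}\<close> matter: derivatives are taken within \<open>{0..1}\<close> (hence
  one-sided at the end points), and functions are compared only on \<open>{0..1}\<close>.
\<close>

abbreviation \<I> :: "real set"
  where "\<I> \<equiv> {0..1}"

abbreviation L1 :: "(real \<Rightarrow> real) set"
  where "L1 \<equiv> {f. integrable (lebesgue_on \<I>) f}"

text \<open>
  The \<open>\<epsilon>\<close>-\<open>\<delta>\<close> definition. A set \<open>\<D>\<close> with
  \<open>\<D> division_of \<Union>\<D>\<close> is a finite family of nonoverlapping compact intervals,
  and \<open>{Inf K..Sup K} = K\<close> for each member \<open>K\<close>.
\<close>

definition AC :: "(real \<Rightarrow> real) set"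
  where "AC = {f. \<forall>\<epsilon>>0. \<exists>\<delta>>0. \<forall>\<D>.
    \<D> division_of \<Union>\<D> \<longrightarrow> \<Union>\<D> \<subseteq> \<I> \<longrightarrow> (\<Sum>K\<in>\<D>. Sup K - Inf K) < \<delta> \<longrightarrow>
    (\<Sum>K\<in>\<D>. \<bar>f (Sup K) - f (Inf K)\<bar>) < \<epsilon>}"

definition D\<^sub>I :: "(real \<Rightarrow> real) \<Rightarrow> real \<Rightarrow> real"
  where "D\<^sub>I u t = vector_derivative u (at t within \<I>)"

definition W21 :: "(real \<Rightarrow> real) set"
  where "W21 = {u. continuous_on \<I> u \<and> u differentiable_on \<I> \<and> D\<^sub>I u \<in> AC}"

definition X_D :: "(real \<Rightarrow> real) set"
  where "X_D = {u \<in> W21. u 0 = 0 \<and> u 1 = 0}"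

definition X_P :: "(real \<Rightarrow> real) set"
  where "X_P = {u \<in> W21. u 0 = u 1 \<and> D\<^sub>I u 0 = D\<^sub>I u 1}"

definition L_op :: "(real \<Rightarrow> real) \<Rightarrow> real \<Rightarrow> (real \<Rightarrow> real) \<Rightarrow> real \<Rightarrow> real"
  where "L_op a lam u t = D\<^sub>I (D\<^sub>I u) t + (a t + lam) * u t"

text \<open>
  The equation \<open>u'' + (a + lam) u = \<sigma>\<close> a.e. on the unit interval. The differentiability
  conjunct says that \<open>u''\<close> exists at the point, so that no value chosen by
  \<open>vector_derivative\<close> at a point of nondifferentiability ever enters the equation.
\<close>

definition solves :: "(real \<Rightarrow> real) \<Rightarrow> real \<Rightarrow> (real \<Rightarrow> real) \<Rightarrow> (real \<Rightarrow> real) \<Rightarrow> bool"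
  where "solves a lam \<sigma> u \<longleftrightarrow>
    (AE t in lebesgue_on \<I>. D\<^sub>I u differentiable (at t within \<I>) \<and> L_op a lam u t = \<sigma> t)"

definition nonresonant :: "(real \<Rightarrow> real) \<Rightarrow> real \<Rightarrow> (real \<Rightarrow> real) set \<Rightarrow> bool"
  where "nonresonant a lam X \<longleftrightarrow>
    (\<forall>u\<in>X. solves a lam (\<lambda>t. 0) u \<longrightarrow> (\<forall>t\<in>\<I>. u t = 0))"

text \<open>
  For every \<open>\<sigma>\<close> in \<open>L1\<close> the solutions \<open>u\<close> of the problem in \<open>X\<close> are exactly the
  functions that coincide on the unit interval with the integral of \<open>G t s * \<sigma> s\<close>; thus there
  is a solution, it is unique, and it is given by the kernel \<open>G\<close>.
\<close>

definition greens_function ::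
    "(real \<Rightarrow> real) \<Rightarrow> real \<Rightarrow> (real \<Rightarrow> real) set \<Rightarrow> (real \<Rightarrow> real \<Rightarrow> real) \<Rightarrow> bool"
  where "greens_function a lam X G \<longleftrightarrow>
    continuous_on (\<I> \<times> \<I>) (\<lambda>(t, s). G t s) \<and>
    (\<forall>\<sigma>\<in>L1. \<forall>u. u \<in> X \<and> solves a lam \<sigma> u \<longleftrightarrow>
       (\<forall>t\<in>\<I>. u t = (\<integral>s. G t s * \<sigma> s \<partial>lebesgue_on \<I>)))"

definition is_r4 :: "(real \<Rightarrow> real) \<Rightarrow> real \<Rightarrow> (real \<Rightarrow> real) \<Rightarrow> bool"
  where "is_r4 a lam r \<longleftrightarrow> r \<in> W21 \<and> solves a lam (\<lambda>t. 0) r \<and>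
    r 0 - r 1 = 0 \<and> D\<^sub>I r 0 - D\<^sub>I r 1 = 1"

end

theory Submission
  imports Defs
begin

text \<open>
  The solution of the Dirichlet problem is the solution of the periodic problem corrected by a
  multiple of \<open>r4\<close>. Indeed \<open>r4\<close> solves the homogeneous equation and takes the same value at both ends,
  as does the periodic solution \<open>v\<close>; since \<open>r4 1 \<noteq> 0\<close>, the function \<open>v - (v 1 / r4 1) r4\<close> vanishes at
  both ends. Inserting the integral representation of \<open>v\<close> turns this into the first formula for the
  kernel (\<open>dirichlet_greens_function\<close>). That it is the only Dirichlet solution follows from periodic
  nonresonance (\<open>dirichlet_nonresonant\<close>), and a continuous kernel is determined by the solutions that
  it represents (\<open>greens_function_unique\<close>).

  The second formula is the first one together with \<open>G_P t 0 = r4 t\<close>. Heuristically, \<open>G_P t 0\<close> is the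
  response to a unit mass at \<open>0\<close>, and \<open>r4\<close> is the homogeneous solution that is periodic but for a unit
  jump of its derivative there. The proof avoids point masses. Lagrange's identity for \<open>r4\<close> and a periodic
  solution \<open>u\<close> with right-hand side \<open>\<tau>\<close> gives \<open>u 0\<close> as the integral of \<open>r4 * \<tau>\<close>, so that
  \<open>G_P 0 s = r4 s\<close>; and \<open>G_P\<close> is symmetric, again by Lagrange's identity and an exchange of two
  integrals (\<open>periodic_greens_function_symmetric\<close>).

  Lagrange's identity integrates a function that is differentiable only almost everywhere. What makes
  it hold is the fundamental theorem of calculus for absolutely continuous functions
  (\<open>AC_has_integral_derivative\<close>), which is proved from the \<open>\<epsilon>\<close>-\<open>\<delta>\<close> definition with a gauge.
\<close>

section \<open>Absolutely continuous functions\<close>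

lemma division_of_real_memE:
  fixes K :: "real set"
  assumes "\<D> division_of S" "K \<in> \<D>"
  obtains p q where "p \<le> q" "K = {p..q}"
proof -
  obtain p q where "K = cbox p q" using division_ofD(4)[OF assms] by blast
  then show ?thesis using that[of p q] division_ofD(3)[OF assms] by simp
qed

text \<open>
  One estimate carries all closure properties of \<open>AC\<close>: linear combinations, products (the other
  factor being bounded) and Lipschitz functions all have increments dominated in this way.
\<close>

lemma AC_combine:
  assumes "f \<in> AC" "g \<in> AC"
    and bound: "\<And>x y. x \<in> \<I> \<Longrightarrow> y \<in> \<I> \<Longrightarrow> \<bar>h x - h y\<bar> \<le> A * \<bar>f x - f y\<bar> + B * \<bar>g x - g y\<bar>"
  shows "h \<in> AC"
  unfolding AC_def
proof (intro CollectI allI impI)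
  fix \<epsilon> :: real assume "\<epsilon> > 0"
  \<comment> \<open>The bound \<open>1\<close> makes division by \<open>C\<close> possible when \<open>A\<close> and \<open>B\<close> are not positive.\<close>
  define C where "C = max 1 (max A B)"
  have C: "C > 0" "A \<le> C" "B \<le> C" by (auto simp: C_def)
  have "\<epsilon> / (2 * C) > 0" using \<open>\<epsilon> > 0\<close> C by simp
  obtain d1 where d1: "d1 > 0" "\<And>\<D>. \<D> division_of \<Union>\<D> \<Longrightarrow> \<Union>\<D> \<subseteq> \<I> \<Longrightarrow>
      (\<Sum>K\<in>\<D>. Sup K - Inf K) < d1 \<Longrightarrow> (\<Sum>K\<in>\<D>. \<bar>f (Sup K) - f (Inf K)\<bar>) < \<epsilon> / (2 * C)"
    using \<open>f \<in> AC\<close> \<open>\<epsilon> / (2 * C) > 0\<close> unfolding AC_def by blast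
  obtain d2 where d2: "d2 > 0" "\<And>\<D>. \<D> division_of \<Union>\<D> \<Longrightarrow> \<Union>\<D> \<subseteq> \<I> \<Longrightarrow>
      (\<Sum>K\<in>\<D>. Sup K - Inf K) < d2 \<Longrightarrow> (\<Sum>K\<in>\<D>. \<bar>g (Sup K) - g (Inf K)\<bar>) < \<epsilon> / (2 * C)"
    using \<open>g \<in> AC\<close> \<open>\<epsilon> / (2 * C) > 0\<close> unfolding AC_def by blast
  show "\<exists>\<delta>>0. \<forall>\<D>. \<D> division_of \<Union>\<D> \<longrightarrow> \<Union>\<D> \<subseteq> \<I> \<longrightarrow>
      (\<Sum>K\<in>\<D>. Sup K - Inf K) < \<delta> \<longrightarrow> (\<Sum>K\<in>\<D>. \<bar>h (Sup K) - h (Inf K)\<bar>) < \<epsilon>"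
  proof (intro exI[of _ "min d1 d2"] conjI allI impI)
    fix \<D> assume D: "\<D> division_of \<Union>\<D>" "\<Union>\<D> \<subseteq> \<I>" "(\<Sum>K\<in>\<D>. Sup K - Inf K) < min d1 d2"
    have "\<bar>h (Sup K) - h (Inf K)\<bar> \<le> C * \<bar>f (Sup K) - f (Inf K)\<bar> + C * \<bar>g (Sup K) - g (Inf K)\<bar>"
      if K: "K \<in> \<D>" for K
    proof -
      obtain p q where pq: "p \<le> q" "K = {p..q}"
        using division_of_real_memE[OF D(1) K] .
      moreover have "K \<subseteq> \<I>" using D(2) K by blast
      ultimately have "Sup K \<in> \<I>" "Inf K \<in> \<I>" by auto
      then have "\<bar>h (Sup K) - h (Inf K)\<bar> \<le> A * \<bar>f (Sup K) - f (Inf K)\<bar> + B * \<bar>g (Sup K) - g (Inf K)\<bar>"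
        by (rule bound)
      also have "\<dots> \<le> C * \<bar>f (Sup K) - f (Inf K)\<bar> + C * \<bar>g (Sup K) - g (Inf K)\<bar>"
        using C by (intro add_mono mult_right_mono) auto
      finally show ?thesis .
    qed
    then have "(\<Sum>K\<in>\<D>. \<bar>h (Sup K) - h (Inf K)\<bar>)
        \<le> C * (\<Sum>K\<in>\<D>. \<bar>f (Sup K) - f (Inf K)\<bar>) + C * (\<Sum>K\<in>\<D>. \<bar>g (Sup K) - g (Inf K)\<bar>)"
      unfolding sum_distrib_left sum.distrib[symmetric] by (rule sum_mono)
    also have "\<dots> < C * (\<epsilon> / (2 * C)) + C * (\<epsilon> / (2 * C))"
      using C D by (intro add_strict_mono mult_strict_left_mono d1(2) d2(2)) auto
    also have "\<dots> = \<epsilon>" using C by (simp add: field_simps)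
    finally show "(\<Sum>K\<in>\<D>. \<bar>h (Sup K) - h (Inf K)\<bar>) < \<epsilon>" .
  qed (use d1 d2 in auto)
qed

lemma AC_lipschitz:
  assumes "\<And>x y. x \<in> \<I> \<Longrightarrow> y \<in> \<I> \<Longrightarrow> \<bar>h x - h y\<bar> \<le> B * \<bar>x - y\<bar>"
  shows "h \<in> AC"
proof -
  have "(\<Sum>K\<in>\<D>. \<bar>Sup K - Inf K\<bar>) = (\<Sum>K\<in>\<D>. Sup K - Inf K)"
    if D: "\<D> division_of \<Union>\<D>" for \<D> :: "real set set"
  proof (rule sum.cong)
    fix K assume "K \<in> \<D>"
    then obtain p q where "p \<le> q" "K = {p..q}"
      using division_of_real_memE[OF D] by blast
    then show "\<bar>Sup K - Inf K\<bar> = Sup K - Inf K" by simp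
  qed simp
  then have id: "(\<lambda>x. x) \<in> AC"
    unfolding AC_def by auto
  show ?thesis
    by (rule AC_combine[OF id id, of _ B 0]) (use assms in auto)
qed

lemma AC_imp_continuous_on:
  assumes "f \<in> AC"
  shows "continuous_on \<I> f"
  unfolding continuous_on_iff dist_real_def
proof (intro ballI allI impI)
  fix x \<epsilon> :: real assume "x \<in> \<I>" "\<epsilon> > 0"
  obtain d where d: "d > 0" "\<And>\<D>. \<D> division_of \<Union>\<D> \<Longrightarrow> \<Union>\<D> \<subseteq> \<I> \<Longrightarrow>
      (\<Sum>K\<in>\<D>. Sup K - Inf K) < d \<Longrightarrow> (\<Sum>K\<in>\<D>. \<bar>f (Sup K) - f (Inf K)\<bar>) < \<epsilon>"
    using assms \<open>\<epsilon> > 0\<close> unfolding AC_def by blast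
  show "\<exists>d>0. \<forall>y\<in>\<I>. \<bar>y - x\<bar> < d \<longrightarrow> \<bar>f y - f x\<bar> < \<epsilon>"
  proof (intro exI[of _ d] conjI ballI impI)
    fix y assume y: "y \<in> \<I>" "\<bar>y - x\<bar> < d"
    have less: "\<bar>f q - f p\<bar> < \<epsilon>" if "p \<le> q" "q - p < d" "p \<in> \<I>" "q \<in> \<I>" for p q
    proof -
      have "{{p..q}} division_of {p..q}"
        using division_of_self[of p q] that by simp
      then show ?thesis using d(2)[of "{{p..q}}"] that by simp
    qed
    show "\<bar>f y - f x\<bar> < \<epsilon>"
      using less[of x y] less[of y x] y \<open>x \<in> \<I>\<close> by (cases "x \<le> y") (simp_all add: abs_minus_commute)
  qed (use d in auto)
qed

lemma AC_bounded:
  assumes "f \<in> AC"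
  obtains B where "B \<ge> 0" "\<And>x. x \<in> \<I> \<Longrightarrow> \<bar>f x\<bar> \<le> B"
proof -
  obtain B where "B \<ge> 0" "\<And>x. x \<in> \<I> \<Longrightarrow> norm (f x) \<le> B"
    using continuous_on_compact_bound[OF compact_Icc AC_imp_continuous_on[OF assms]] by blast
  then show ?thesis using that[of B] by simp
qed

lemma AC_add_scaled:
  assumes "f \<in> AC" "g \<in> AC" "\<And>x. x \<in> \<I> \<Longrightarrow> h x = f x + c * g x"
  shows "h \<in> AC"
proof (rule AC_combine[OF assms(1,2), of _ 1 "\<bar>c\<bar>"])
  fix x y :: real assume "x \<in> \<I>" "y \<in> \<I>"
  then have "h x - h y = (f x - f y) + c * (g x - g y)" by (simp add: assms(3) algebra_simps)
  then show "\<bar>h x - h y\<bar> \<le> 1 * \<bar>f x - f y\<bar> + \<bar>c\<bar> * \<bar>g x - g y\<bar>"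
    by (metis abs_mult abs_triangle_ineq mult_1)
qed

lemma AC_mult:
  assumes "f \<in> AC" "g \<in> AC"
  shows "(\<lambda>x. f x * g x) \<in> AC"
proof -
  obtain A where A: "A \<ge> 0" "\<And>x. x \<in> \<I> \<Longrightarrow> \<bar>f x\<bar> \<le> A" using AC_bounded[OF assms(1)] by blast
  obtain B where B: "B \<ge> 0" "\<And>x. x \<in> \<I> \<Longrightarrow> \<bar>g x\<bar> \<le> B" using AC_bounded[OF assms(2)] by blast
  show ?thesis
  proof (rule AC_combine[OF assms, of _ B A])
    fix x y :: real assume xy: "x \<in> \<I>" "y \<in> \<I>"
    have "f x * g x - f y * g y = g x * (f x - f y) + f y * (g x - g y)" by (simp add: algebra_simps)
    then have "\<bar>f x * g x - f y * g y\<bar> \<le> \<bar>g x\<bar> * \<bar>f x - f y\<bar> + \<bar>f y\<bar> * \<bar>g x - g y\<bar>"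
      by (metis abs_mult abs_triangle_ineq)
    also have "\<dots> \<le> B * \<bar>f x - f y\<bar> + A * \<bar>g x - g y\<bar>"
      using A B xy by (intro add_mono mult_right_mono) auto
    finally show "\<bar>f x * g x - f y * g y\<bar> \<le> B * \<bar>f x - f y\<bar> + A * \<bar>g x - g y\<bar>" .
  qed
qed

section \<open>The fundamental theorem of calculus\<close>

text \<open>
  The fundamental theorem of calculus for absolutely continuous functions, in the gauge integral.
  The increment of \<open>F\<close> is the sum of its increments over the members of a tagged division. Where
  the tag is a point of differentiability, the increment is close to the Riemann term. The members
  tagged in the exceptional null set are kept inside an open set of small measure, so that absolute
  continuity makes their increments small altogether.
\<close>

lemma AC_has_integral_derivative:
  assumes F: "F \<in> AC" and N: "negligible N"
    and deriv: "\<And>t. t \<in> \<I> - N \<Longrightarrow> (F has_vector_derivative g t) (at t within \<I>)"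
  shows "(g has_integral F 1 - F 0) \<I>"
proof -
  define h where "h t = (if t \<in> N then 0 else g t)" for t
  have "(h has_integral F 1 - F 0) \<I>"
    unfolding has_integral_real
  proof (intro allI impI)
    fix e :: real assume "e > 0"
    obtain \<delta> where \<delta>: "\<delta> > 0" "\<And>\<D>. \<D> division_of \<Union>\<D> \<Longrightarrow> \<Union>\<D> \<subseteq> \<I> \<Longrightarrow>
        (\<Sum>K\<in>\<D>. Sup K - Inf K) < \<delta> \<Longrightarrow> (\<Sum>K\<in>\<D>. \<bar>F (Sup K) - F (Inf K)\<bar>) < e / 2"
      using F \<open>e > 0\<close> half_gt_zero[OF \<open>e > 0\<close>] unfolding AC_def by blast
    have N0: "N \<in> null_sets lebesgue" using N by (simp add: negligible_iff_null_sets)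
    then obtain U where U: "open U" "N \<subseteq> U" "U - N \<in> lmeasurable" "emeasure lebesgue (U - N) < ennreal \<delta>"
      using sets_lebesgue_outer_open[of N \<delta>] \<delta>(1) by auto
    have Uset: "U \<in> sets lebesgue" using U(1) by auto
    have "emeasure lebesgue U < ennreal \<delta>"
      using U(4) emeasure_Diff_null_set[OF N0 Uset] by simp
    then have Ufin: "U \<in> lmeasurable"
      using Uset by (intro fmeasurableI) (auto intro: order_less_trans)
    with \<open>emeasure lebesgue U < ennreal \<delta>\<close> have Um: "measure lebesgue U < \<delta>"
      by (simp add: emeasure_eq_measure2 ennreal_less_iff)
    have "\<exists>d>0. \<forall>y\<in>\<I>. \<bar>y - t\<bar> < d \<longrightarrow> \<bar>F y - F t - (y - t) * h t\<bar> \<le> e / 2 * \<bar>y - t\<bar>"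
      if "t \<in> \<I> - N" for t
    proof -
      have "(F has_vector_derivative h t) (at t within \<I>)"
        using deriv[OF that] that by (simp add: h_def)
      then show ?thesis
        using half_gt_zero[OF \<open>e > 0\<close>]
        unfolding has_vector_derivative_def has_derivative_within_alt real_norm_def real_scaleR_def
        by blast
    qed
    then obtain d where d: "\<And>t. t \<in> \<I> - N \<Longrightarrow> d t > 0"
      "\<And>t y. t \<in> \<I> - N \<Longrightarrow> y \<in> \<I> \<Longrightarrow> \<bar>y - t\<bar> < d t \<Longrightarrow> \<bar>F y - F t - (y - t) * h t\<bar> \<le> e / 2 * \<bar>y - t\<bar>"
      by metis
    \<comment> \<open>Tags in the exceptional set only see a small open set around it; the others see a
      neighbourhood in which the difference quotient is good.\<close>
    define \<gamma> where "\<gamma> t = (if t \<in> N then U else if t \<in> \<I> then ball t (d t) else ball t 1)" for t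
    have "gauge \<gamma>" unfolding gauge_def \<gamma>_def using U d by auto
    show "\<exists>\<gamma>. gauge \<gamma> \<and> (\<forall>\<D>. \<D> tagged_division_of \<I> \<and> \<gamma> fine \<D> \<longrightarrow>
        norm ((\<Sum>(x, k)\<in>\<D>. measure lborel k *\<^sub>R h x) - (F 1 - F 0)) < e)"
    proof (intro exI[of _ \<gamma>] conjI allI impI)
      fix D assume "D tagged_division_of \<I> \<and> \<gamma> fine D"
      then have D: "D tagged_division_of \<I>" and fine: "\<gamma> fine D" by auto
      note Dd = tagged_division_ofD[OF D]
      have shape: "\<exists>p q. K = {p..q} \<and> p \<le> x \<and> x \<le> q \<and> 0 \<le> p \<and> q \<le> 1" if xK: "(x, K) \<in> D" for x K
      proof -
        obtain p q where "K = {p..q}" using Dd(4)[OF xK] unfolding cbox_interval by blast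
        moreover have "x \<in> K" "K \<subseteq> \<I>" using Dd(2,3)[OF xK] .
        ultimately show ?thesis by (intro exI[of _ p] exI[of _ q]) auto
      qed
      define DN where "DN = {z \<in> D. fst z \<in> N}"
      have DN: "DN tagged_partial_division_of \<I>"
        using tagged_partial_division_subset[of D \<I> DN] D by (auto simp: DN_def tagged_division_of_def)
      have DNdiv: "(snd ` DN) division_of \<Union>(snd ` DN)"
        by (rule partial_division_of_tagged_division[OF DN])
      have DNsub: "\<Union>(snd ` DN) \<subseteq> \<I>"
        using Dd(3) unfolding DN_def by fastforce
      have DNU: "\<Union>(snd ` DN) \<subseteq> U"
        using fineD[OF fine] unfolding DN_def \<gamma>_def by fastforce
      have "(\<Sum>K\<in>snd ` DN. Sup K - Inf K) = (\<Sum>K\<in>snd ` DN. measure lebesgue K)"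
      proof (rule sum.cong)
        fix K assume "K \<in> snd ` DN"
        then obtain x where "(x, K) \<in> D" by (auto simp: DN_def)
        then show "Sup K - Inf K = measure lebesgue K" using shape by fastforce
      qed simp
      also have "\<dots> = measure lebesgue (\<Union>(snd ` DN))" by (rule content_division[OF DNdiv])
      also have "\<dots> \<le> measure lebesgue U"
        using lmeasurable_division[OF DNdiv] Ufin DNU by (intro measure_mono_fmeasurable) auto
      finally have "(\<Sum>K\<in>snd ` DN. \<bar>F (Sup K) - F (Inf K)\<bar>) < e / 2"
        using \<delta>(2)[OF DNdiv DNsub] Um by simp
      moreover have "(\<Sum>(x,K)\<in>DN. \<bar>measure lborel K * h x - (F (Sup K) - F (Inf K))\<bar>)
          = (\<Sum>K\<in>snd ` DN. \<bar>F (Sup K) - F (Inf K)\<bar>)"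
      proof -
        define v where "v K = (if K = {} then 0 else \<bar>F (Sup K) - F (Inf K)\<bar>)" for K
        have "(\<Sum>(x,K)\<in>DN. \<bar>measure lborel K * h x - (F (Sup K) - F (Inf K))\<bar>) = (\<Sum>(x,K)\<in>DN. v K)"
          using shape by (intro sum.cong) (fastforce simp: DN_def h_def v_def)+
        also have "\<dots> = (\<Sum>K\<in>snd ` DN. v K)"
          by (rule sum.over_tagged_division_lemma[OF tagged_partial_division_of_Union_self[OF DN]])
            (auto simp: v_def)
        also have "\<dots> = (\<Sum>K\<in>snd ` DN. \<bar>F (Sup K) - F (Inf K)\<bar>)"
          using shape by (intro sum.cong) (fastforce simp: DN_def v_def)+
        finally show ?thesis .
      qed
      ultimately have small: "(\<Sum>(x,K)\<in>DN. \<bar>measure lborel K * h x - (F (Sup K) - F (Inf K))\<bar>) < e / 2"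
        by simp
      have "(\<Sum>(x,K)\<in>D - DN. \<bar>measure lborel K * h x - (F (Sup K) - F (Inf K))\<bar>)
          \<le> (\<Sum>(x,K)\<in>D - DN. e / 2 * measure lborel K)"
      proof (rule sum_mono, clarify)
        fix x K assume xK: "(x, K) \<in> D" "(x, K) \<notin> DN"
        obtain p q where pq: "K = {p..q}" "p \<le> x" "x \<le> q" "0 \<le> p" "q \<le> 1"
          using shape[OF xK(1)] by auto
        have x: "x \<in> \<I> - N" using xK pq by (auto simp: DN_def)
        have "K \<subseteq> ball x (d x)" using fineD[OF fine xK(1)] x by (simp add: \<gamma>_def)
        moreover have "p \<in> K" "q \<in> K" using pq by auto
        ultimately have "p \<in> ball x (d x)" "q \<in> ball x (d x)" by blast+
        then have "\<bar>F p - F x - (p - x) * h x\<bar> \<le> e / 2 * \<bar>p - x\<bar>"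
          "\<bar>F q - F x - (q - x) * h x\<bar> \<le> e / 2 * \<bar>q - x\<bar>"
          using d(2)[OF x, of p] d(2)[OF x, of q] pq by (auto simp: dist_real_def abs_minus_commute)
        moreover have "measure lborel K * h x - (F q - F p)
            = (F p - F x - (p - x) * h x) - (F q - F x - (q - x) * h x)"
          using pq by (simp add: algebra_simps)
        ultimately have "\<bar>measure lborel K * h x - (F q - F p)\<bar> \<le> e / 2 * \<bar>p - x\<bar> + e / 2 * \<bar>q - x\<bar>"
          by linarith
        also have "\<dots> = e / 2 * measure lborel K" using pq by (simp add: field_simps)
        finally show "\<bar>measure lborel K * h x - (F (Sup K) - F (Inf K))\<bar> \<le> e / 2 * measure lborel K"
          using pq by simp
      qed
      also have "\<dots> \<le> (\<Sum>(x,K)\<in>D. e / 2 * measure lborel K)"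
        using Dd(1) \<open>e > 0\<close> by (intro sum_mono2) auto
      also have "\<dots> = e / 2 * (\<Sum>(x,K)\<in>D. measure lborel K)"
        by (simp add: sum_distrib_left case_prod_unfold)
      also have "\<dots> = e / 2"
        using additive_content_tagged_division[of D 0 1] D by simp
      finally have large: "(\<Sum>(x,K)\<in>D - DN. \<bar>measure lborel K * h x - (F (Sup K) - F (Inf K))\<bar>) \<le> e / 2" .
      have "(\<Sum>(x, k)\<in>D. measure lborel k *\<^sub>R h x) - (F 1 - F 0)
          = (\<Sum>(x,K)\<in>D. measure lborel K * h x - (F (Sup K) - F (Inf K)))"
        using additive_tagged_division_1[of 0 1 D F] D by (simp add: case_prod_unfold sum_subtractf)
      then have "norm ((\<Sum>(x, k)\<in>D. measure lborel k *\<^sub>R h x) - (F 1 - F 0))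
          \<le> (\<Sum>(x,K)\<in>D. \<bar>measure lborel K * h x - (F (Sup K) - F (Inf K))\<bar>)"
        using sum_abs[of "\<lambda>(x,K). measure lborel K * h x - (F (Sup K) - F (Inf K))" D]
        by (simp add: case_prod_unfold)
      also have "\<dots> = (\<Sum>(x,K)\<in>D - DN. \<bar>measure lborel K * h x - (F (Sup K) - F (Inf K))\<bar>)
          + (\<Sum>(x,K)\<in>DN. \<bar>measure lborel K * h x - (F (Sup K) - F (Inf K))\<bar>)"
        using Dd(1) by (intro sum.subset_diff) (auto simp: DN_def)
      also have "\<dots> < e" using small large by simp
      finally show "norm ((\<Sum>(x, k)\<in>D. measure lborel k *\<^sub>R h x) - (F 1 - F 0)) < e" .
    qed fact
  qed
  then show ?thesis
    by (rule has_integral_spike[OF N, rotated]) (auto simp: h_def)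
qed

section \<open>Linearity of the equation\<close>

lemma D\<^sub>I_eqI:
  assumes "t \<in> \<I>" "(u has_vector_derivative d) (at t within \<I>)"
  shows "D\<^sub>I u t = d"
  using assms vector_derivative_within_closed_interval[of 0 1 t u d] by (simp add: D\<^sub>I_def)

lemma W21_has_vector_derivative:
  assumes "u \<in> W21" "t \<in> \<I>"
  shows "(u has_vector_derivative D\<^sub>I u t) (at t within \<I>)"
  using assms unfolding W21_def differentiable_on_def D\<^sub>I_def by (auto simp: vector_derivative_works)

lemma has_vector_derivative_add_scaled:
  fixes f g h :: "real \<Rightarrow> real"
  assumes "(f has_vector_derivative f') (at t within S)" "(g has_vector_derivative g') (at t within S)"
    and "t \<in> S" "\<And>x. x \<in> S \<Longrightarrow> h x = f x + c * g x"
  shows "(h has_vector_derivative f' + c * g') (at t within S)"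
proof (rule has_vector_derivative_transform[OF assms(3)])
  show "((\<lambda>x. f x + c * g x) has_vector_derivative f' + c * g') (at t within S)"
    by (intro has_vector_derivative_add has_vector_derivative_mult_right assms(1,2))
qed (rule assms(4))

text \<open>
  Only values on the unit interval matter to \<open>D\<^sub>I\<close>, \<open>W21\<close> and \<open>solves\<close>. The closure lemmas for
  \<open>f + c * g\<close> are therefore stated for any function that agrees with it there; the case \<open>c = 0\<close>
  serves to pass between functions that agree on the interval.
\<close>

lemma D\<^sub>I_add_scaled:
  assumes "f \<in> W21" "g \<in> W21" "\<And>x. x \<in> \<I> \<Longrightarrow> h x = f x + c * g x" "t \<in> \<I>"
  shows "D\<^sub>I h t = D\<^sub>I f t + c * D\<^sub>I g t"
  by (rule D\<^sub>I_eqI[OF assms(4)], rule has_vector_derivative_add_scaled)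
    (use assms W21_has_vector_derivative in auto)

lemma W21_add_scaled:
  assumes "f \<in> W21" "g \<in> W21" "\<And>x. x \<in> \<I> \<Longrightarrow> h x = f x + c * g x"
  shows "h \<in> W21"
proof -
  have "D\<^sub>I h \<in> AC"
    by (rule AC_add_scaled[of "D\<^sub>I f" "D\<^sub>I g"])
      (use assms D\<^sub>I_add_scaled[OF assms] in \<open>auto simp: W21_def\<close>)
  moreover have "(h has_vector_derivative D\<^sub>I f t + c * D\<^sub>I g t) (at t within \<I>)" if "t \<in> \<I>" for t
    by (rule has_vector_derivative_add_scaled) (use assms that W21_has_vector_derivative in auto)
  then have "h differentiable_on \<I>"
    unfolding differentiable_on_def by (blast intro: differentiableI_vector)
  ultimately show ?thesis
    by (auto simp: W21_def intro: differentiable_imp_continuous_on)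
qed

lemma solves_add_scaled:
  assumes "f \<in> W21" "g \<in> W21" "solves a lam \<sigma> f" "solves a lam \<tau> g"
    and h: "\<And>x. x \<in> \<I> \<Longrightarrow> h x = f x + c * g x"
  shows "solves a lam (\<lambda>t. \<sigma> t + c * \<tau> t) h"
  using assms(3,4) AE_space[of "lebesgue_on \<I>"] unfolding solves_def
proof eventually_elim
  case (elim t)
  then have t: "t \<in> \<I>" by simp
  have "(D\<^sub>I f has_vector_derivative D\<^sub>I (D\<^sub>I f) t) (at t within \<I>)"
    "(D\<^sub>I g has_vector_derivative D\<^sub>I (D\<^sub>I g) t) (at t within \<I>)"
    using elim by (auto simp: vector_derivative_works D\<^sub>I_def[of "D\<^sub>I _"])
  then have *: "(D\<^sub>I h has_vector_derivative D\<^sub>I (D\<^sub>I f) t + c * D\<^sub>I (D\<^sub>I g) t) (at t within \<I>)"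
    by (rule has_vector_derivative_add_scaled[OF _ _ t D\<^sub>I_add_scaled[OF assms(1,2) h]])
  have "L_op a lam h t = L_op a lam f t + c * L_op a lam g t"
    by (simp add: L_op_def D\<^sub>I_eqI[OF t *] h[OF t] algebra_simps)
  then show ?case
    using elim * by (auto intro: differentiableI_vector)
qed

text \<open>
  The derivative is continuous on a compact interval, hence bounded.
\<close>

lemma W21_imp_AC:
  assumes "u \<in> W21"
  shows "u \<in> AC"
proof -
  have "D\<^sub>I u \<in> AC" using assms by (simp add: W21_def)
  then obtain B where B: "\<And>x. x \<in> \<I> \<Longrightarrow> \<bar>D\<^sub>I u x\<bar> \<le> B" using AC_bounded by blast
  show ?thesis
  proof (rule AC_lipschitz)
    fix x y :: real assume "x \<in> \<I>" "y \<in> \<I>"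
    then show "\<bar>u x - u y\<bar> \<le> B * \<bar>x - y\<bar>"
      using field_differentiable_bound[of \<I> u "D\<^sub>I u" B x y] B W21_has_vector_derivative[OF assms]
      by (simp add: has_real_derivative_iff_has_vector_derivative)
  qed
qed

section \<open>Lagrange's identity and its boundary terms\<close>

lemma solves_exceptional_set:
  assumes "solves a lam \<sigma> u"
  obtains N where "negligible N"
    "\<And>t. t \<in> \<I> - N \<Longrightarrow> (D\<^sub>I u has_vector_derivative \<sigma> t - (a t + lam) * u t) (at t within \<I>)"
proof -
  obtain N where N: "N \<in> null_sets (lebesgue_on \<I>)" "\<And>t. t \<in> \<I> - N \<Longrightarrow>
      D\<^sub>I u differentiable (at t within \<I>) \<and> L_op a lam u t = \<sigma> t"
    using AE_E3[OF assms[unfolded solves_def]] unfolding space_lebesgue_on by blast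
  have "negligible N"
    using N(1) by (simp add: negligible_iff_null_sets null_sets_restrict_space)
  moreover have "(D\<^sub>I u has_vector_derivative \<sigma> t - (a t + lam) * u t) (at t within \<I>)"
    if "t \<in> \<I> - N" for t
  proof -
    have "(D\<^sub>I u has_vector_derivative D\<^sub>I (D\<^sub>I u) t) (at t within \<I>)"
      using N(2)[OF that] by (simp add: vector_derivative_works D\<^sub>I_def[of "D\<^sub>I _"])
    moreover have "D\<^sub>I (D\<^sub>I u) t = \<sigma> t - (a t + lam) * u t"
      using N(2)[OF that] by (simp add: L_op_def)
    ultimately show ?thesis by simp
  qed
  ultimately show ?thesis by (rule that)
qed

text \<open>
  The derivative of the Wronskian \<open>u v' - v u'\<close> is \<open>u v'' - v u''\<close>, in which the terms with the
  coefficient \<open>a + lam\<close> cancel.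
\<close>

lemma Lagrange_identity:
  assumes uv: "u \<in> W21" "v \<in> W21" and "solves a lam \<sigma> u" "solves a lam \<tau> v"
  shows "((\<lambda>t. u t * \<tau> t - v t * \<sigma> t) has_integral
    (u 1 * D\<^sub>I v 1 - v 1 * D\<^sub>I u 1) - (u 0 * D\<^sub>I v 0 - v 0 * D\<^sub>I u 0)) \<I>"
proof -
  obtain M where M: "negligible M"
    "\<And>t. t \<in> \<I> - M \<Longrightarrow> (D\<^sub>I u has_vector_derivative \<sigma> t - (a t + lam) * u t) (at t within \<I>)"
    using solves_exceptional_set[OF assms(3)] by blast
  obtain N where N: "negligible N"
    "\<And>t. t \<in> \<I> - N \<Longrightarrow> (D\<^sub>I v has_vector_derivative \<tau> t - (a t + lam) * v t) (at t within \<I>)"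
    using solves_exceptional_set[OF assms(4)] by blast
  define F where "F t = u t * D\<^sub>I v t - v t * D\<^sub>I u t" for t
  have "D\<^sub>I u \<in> AC" "D\<^sub>I v \<in> AC" using uv by (auto simp: W21_def)
  then have "(\<lambda>t. u t * D\<^sub>I v t) \<in> AC" "(\<lambda>t. v t * D\<^sub>I u t) \<in> AC"
    using uv by (auto intro: AC_mult W21_imp_AC)
  then have "F \<in> AC" by (rule AC_add_scaled[of _ _ _ "-1"]) (simp add: F_def)
  moreover have "negligible (M \<union> N)" using M N by simp
  moreover have "(F has_vector_derivative u t * \<tau> t - v t * \<sigma> t) (at t within \<I>)"
    if "t \<in> \<I> - (M \<union> N)" for t
  proof -
    have "t \<in> \<I>" "t \<in> \<I> - M" "t \<in> \<I> - N" using that by auto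
    then have "(F has_vector_derivative
        (u t * (\<tau> t - (a t + lam) * v t) + D\<^sub>I u t * D\<^sub>I v t)
        - (v t * (\<sigma> t - (a t + lam) * u t) + D\<^sub>I v t * D\<^sub>I u t)) (at t within \<I>)"
      unfolding F_def
      by (intro has_vector_derivative_diff has_vector_derivative_mult
          M(2) N(2) W21_has_vector_derivative uv)
    then show ?thesis by (simp add: algebra_simps)
  qed
  ultimately show ?thesis using AC_has_integral_derivative[of F "M \<union> N"] by (simp add: F_def)
qed

text \<open>
  The operator is symmetric on the periodic space, all boundary terms cancelling in pairs.
\<close>

lemma periodic_symmetric:
  assumes "u \<in> X_P" "v \<in> X_P" "solves a lam \<sigma> u" "solves a lam \<tau> v"
  shows "((\<lambda>t. u t * \<tau> t - v t * \<sigma> t) has_integral 0) \<I>"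
  using Lagrange_identity[of u v a lam \<sigma> \<tau>] assms by (simp add: X_P_def)

text \<open>
  Pairing with \<open>r\<close> evaluates periodic functions at the end point: the boundary term that the
  periodic conditions would cancel is left over exactly because \<open>r'\<close> has a unit jump. This is the
  weak form of the statement that \<open>r\<close> solves the periodic problem with a point mass at \<open>0\<close>.
\<close>

lemma is_r4_reproducing:
  assumes "is_r4 a lam r" "u \<in> X_P" "solves a lam \<tau> u"
  shows "((\<lambda>t. r t * \<tau> t) has_integral u 0) \<I>"
proof -
  have "(r 1 * D\<^sub>I u 1 - u 1 * D\<^sub>I r 1) - (r 0 * D\<^sub>I u 0 - u 0 * D\<^sub>I r 0)
      = u 0 * (D\<^sub>I r 0 - D\<^sub>I r 1)"
    using assms by (simp add: is_r4_def X_P_def algebra_simps)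
  also have "\<dots> = u 0" using assms by (simp add: is_r4_def)
  finally show ?thesis
    using Lagrange_identity[of r u a lam "\<lambda>t. 0" \<tau>] assms by (simp add: is_r4_def X_P_def)
qed

section \<open>Integrals of continuous kernels\<close>

lemma continuous_on_\<I>_L1: "continuous_on \<I> f \<Longrightarrow> f \<in> L1"
  by (simp add: continuous_imp_integrable_real)

lemma continuous_on_row:
  assumes "continuous_on (\<I> \<times> \<I>) (\<lambda>(t, s). G t s)" "t \<in> \<I>"
  shows "continuous_on \<I> (G t)"
  by (rule continuous_on_compose2[OF assms(1), of _ "\<lambda>s. (t, s)", simplified])
    (use assms(2) in \<open>auto intro!: continuous_intros\<close>)

lemma continuous_on_column:
  assumes "continuous_on (\<I> \<times> \<I>) (\<lambda>(t, s). G t s)" "s \<in> \<I>"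
  shows "continuous_on \<I> (\<lambda>t. G t s)"
  by (rule continuous_on_compose2[OF assms(1), of _ "\<lambda>t. (t, s)", simplified])
    (use assms(2) in \<open>auto intro!: continuous_intros\<close>)

lemma integrable_continuous_mult_L1:
  assumes "continuous_on \<I> k" "\<sigma> \<in> L1"
  shows "integrable (lebesgue_on \<I>) (\<lambda>s. k s * \<sigma> s)"
proof -
  obtain B where B: "\<And>x. x \<in> \<I> \<Longrightarrow> \<bar>k x\<bar> \<le> B"
    using continuous_on_compact_bound[OF compact_Icc assms(1)] by (metis real_norm_def)
  have \<sigma>: "integrable (lebesgue_on \<I>) \<sigma>" using assms(2) by simp
  show ?thesis
  proof (rule Bochner_Integration.integrable_bound)
    show "integrable (lebesgue_on \<I>) (\<lambda>s. B * \<sigma> s)" using \<sigma> by simp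
    show "(\<lambda>s. k s * \<sigma> s) \<in> borel_measurable (lebesgue_on \<I>)"
      using continuous_imp_measurable_on_sets_lebesgue[OF assms(1)] borel_measurable_integrable[OF \<sigma>]
      by (intro borel_measurable_times) auto
    show "AE s in lebesgue_on \<I>. norm (k s * \<sigma> s) \<le> norm (B * \<sigma> s)"
      using AE_space
    proof eventually_elim
      case (elim s)
      then have "\<bar>k s\<bar> \<le> \<bar>B\<bar>" using B[of s] by simp
      then show ?case by (simp add: abs_mult mult_right_mono)
    qed
  qed
qed

lemma integral_lebesgue_on_continuous:
  fixes k :: "real \<Rightarrow> real"
  assumes "continuous_on \<I> k" "continuous_on \<I> \<sigma>"
  shows "(\<integral>s. k s * \<sigma> s \<partial>lebesgue_on \<I>) = integral \<I> (\<lambda>s. k s * \<sigma> s)"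
  using assms by (intro lebesgue_integral_eq_integral continuous_imp_integrable_real continuous_on_mult) auto

text \<open>
  The test function \<open>k - l\<close> already separates \<open>k\<close> from \<open>l\<close>. Continuous test functions suffice
  everywhere below, so that iterated integrals only occur for continuous integrands.
\<close>

lemma eq_of_integral_against_continuous:
  fixes k l :: "real \<Rightarrow> real"
  assumes k: "continuous_on \<I> k" and l: "continuous_on \<I> l"
    and eq: "\<And>\<tau>. continuous_on \<I> \<tau> \<Longrightarrow> integral \<I> (\<lambda>s. k s * \<tau> s) = integral \<I> (\<lambda>s. l s * \<tau> s)"
    and "s \<in> \<I>"
  shows "k s = l s"
proof -
  have d: "continuous_on \<I> (\<lambda>s. k s - l s)" using k l by (intro continuous_intros)
  have "integral \<I> (\<lambda>s. (k s - l s) * (k s - l s))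
      = integral \<I> (\<lambda>s. k s * (k s - l s)) - integral \<I> (\<lambda>s. l s * (k s - l s))"
    unfolding left_diff_distrib
    by (intro Henstock_Kurzweil_Integration.integral_diff integrable_continuous_real continuous_intros k l)
  also have "\<dots> = 0" using eq[OF d] by simp
  finally have "\<forall>s\<in>\<I>. (k s - l s) * (k s - l s) = 0"
    using d by (subst (asm) integral_eq_0_iff) (auto intro!: continuous_intros)
  then show ?thesis using \<open>s \<in> \<I>\<close> by auto
qed

section \<open>Uniqueness and symmetry of Green's functions\<close>

lemma greens_functionD:
  assumes "greens_function a lam X G"
  shows "continuous_on (\<I> \<times> \<I>) (\<lambda>(t, s). G t s)"
    and "\<sigma> \<in> L1 \<Longrightarrow> (\<lambda>t. \<integral>s. G t s * \<sigma> s \<partial>lebesgue_on \<I>) \<in> X"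
    and "\<sigma> \<in> L1 \<Longrightarrow> solves a lam \<sigma> (\<lambda>t. \<integral>s. G t s * \<sigma> s \<partial>lebesgue_on \<I>)"
    and "\<sigma> \<in> L1 \<Longrightarrow> u \<in> X \<Longrightarrow> solves a lam \<sigma> u \<Longrightarrow> t \<in> \<I> \<Longrightarrow>
      u t = (\<integral>s. G t s * \<sigma> s \<partial>lebesgue_on \<I>)"
  using assms unfolding greens_function_def by blast+

lemma greens_function_unique:
  assumes G: "greens_function a lam X G" and H: "greens_function a lam X H"
    and "t \<in> \<I>" "s \<in> \<I>"
  shows "G t s = H t s"
proof (rule eq_of_integral_against_continuous[of "G t" "H t"])
  have Gt: "continuous_on \<I> (G t)" and Ht: "continuous_on \<I> (H t)"
    using continuous_on_row greens_functionD(1) G H \<open>t \<in> \<I>\<close> by blast+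
  show "continuous_on \<I> (G t)" "continuous_on \<I> (H t)" by fact+
  fix \<tau> :: "real \<Rightarrow> real" assume \<tau>: "continuous_on \<I> \<tau>"
  show "integral \<I> (\<lambda>s. G t s * \<tau> s) = integral \<I> (\<lambda>s. H t s * \<tau> s)"
    using greens_functionD(4)[OF H continuous_on_\<I>_L1[OF \<tau>]
        greens_functionD(2,3)[OF G continuous_on_\<I>_L1[OF \<tau>]] \<open>t \<in> \<I>\<close>]
    by (simp add: integral_lebesgue_on_continuous[OF Gt \<tau>] integral_lebesgue_on_continuous[OF Ht \<tau>])
qed fact

text \<open>
  With \<open>u\<close> and \<open>v\<close> the solutions for the right-hand sides \<open>\<sigma>\<close> and \<open>\<tau>\<close>, symmetry of the operator
  says that the double integrals of \<open>G t s * \<sigma> s * \<tau> t\<close> and of \<open>G s t * \<sigma> s * \<tau> t\<close> agree. Testing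
  first with all \<open>\<sigma>\<close> and then with all \<open>\<tau>\<close> gives equality of the kernels.
\<close>

lemma periodic_greens_function_symmetric:
  assumes G: "greens_function a lam X_P G" and "t \<in> \<I>" "s \<in> \<I>"
  shows "G t s = G s t"
proof -
  note cont = greens_functionD(1)[OF G]
  note row = continuous_on_row[OF cont]
  note col = continuous_on_column[OF cont]
  have transposed: "integral \<I> (\<lambda>t. G t s * \<tau> t) = integral \<I> (\<lambda>t. G s t * \<tau> t)"
    if \<tau>: "continuous_on \<I> \<tau>" for \<tau>
  proof (rule eq_of_integral_against_continuous[where s = s])
    define v where "v t = (\<integral>s. G t s * \<tau> s \<partial>lebesgue_on \<I>)" for t
    have v: "v t = integral \<I> (\<lambda>s. G t s * \<tau> s)" if "t \<in> \<I>" for t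
      using integral_lebesgue_on_continuous[OF row[OF that] \<tau>] by (simp add: v_def)
    have vX: "v \<in> X_P" "solves a lam \<tau> v"
      using greens_functionD(2,3)[OF G continuous_on_\<I>_L1[OF \<tau>]] by (auto simp: v_def[abs_def])
    have vc: "continuous_on \<I> v" using vX by (simp add: X_P_def W21_def)
    then show "continuous_on \<I> (\<lambda>s. integral \<I> (\<lambda>t. G s t * \<tau> t))"
      by (rule continuous_on_eq) (simp add: v)
    have "continuous_on (\<I> \<times> \<I>) (\<lambda>z. (\<lambda>(t, s). G t s) (snd z, fst z) * \<tau> (snd z))"
      by (intro continuous_on_mult continuous_on_compose2[OF cont] continuous_on_compose2[OF \<tau>]
          continuous_intros) auto
    then show "continuous_on \<I> (\<lambda>s. integral \<I> (\<lambda>t. G t s * \<tau> t))"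
      using integral_continuous_on_param[of \<I> 0 1 "\<lambda>s t. G t s * \<tau> t"]
      by (simp add: case_prod_unfold)
    fix \<sigma> :: "real \<Rightarrow> real" assume \<sigma>: "continuous_on \<I> \<sigma>"
    define u where "u t = (\<integral>s. G t s * \<sigma> s \<partial>lebesgue_on \<I>)" for t
    have u: "u t = integral \<I> (\<lambda>s. G t s * \<sigma> s)" if "t \<in> \<I>" for t
      using integral_lebesgue_on_continuous[OF row[OF that] \<sigma>] by (simp add: u_def)
    have uX: "u \<in> X_P" "solves a lam \<sigma> u"
      using greens_functionD(2,3)[OF G continuous_on_\<I>_L1[OF \<sigma>]] by (auto simp: u_def[abs_def])
    have uc: "continuous_on \<I> u" using uX by (simp add: X_P_def W21_def)
    have "continuous_on (\<I> \<times> \<I>) (\<lambda>z. (\<lambda>(t, s). G t s) z * \<sigma> (snd z) * \<tau> (fst z))"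
      by (intro continuous_on_mult cont continuous_on_compose2[OF \<tau>] continuous_on_compose2[OF \<sigma>]
          continuous_intros) auto
    then have "continuous_on (cbox (0, 0) (1, 1)) (\<lambda>(t, s). G t s * \<sigma> s * \<tau> t)"
      by (simp add: case_prod_unfold cbox_Pair_eq)
    note swap = integral_swap_continuous[OF this]
    have "integral \<I> (\<lambda>s. integral \<I> (\<lambda>t. G t s * \<tau> t) * \<sigma> s)
        = integral \<I> (\<lambda>s. integral \<I> (\<lambda>t. G t s * \<sigma> s * \<tau> t))"
      by (simp add: mult_ac flip: integral_mult_right)
    also have "\<dots> = integral \<I> (\<lambda>t. integral \<I> (\<lambda>s. G t s * \<sigma> s * \<tau> t))"
      using swap by simp
    also have "\<dots> = integral \<I> (\<lambda>t. u t * \<tau> t)"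
      by (rule Henstock_Kurzweil_Integration.integral_cong) (simp add: u)
    also have "\<dots> = integral \<I> (\<lambda>t. v t * \<sigma> t)"
    proof -
      have "integral \<I> (\<lambda>t. u t * \<tau> t - v t * \<sigma> t) = 0"
        using periodic_symmetric[OF uX(1) vX(1) uX(2) vX(2)] by (rule integral_unique)
      moreover have "integral \<I> (\<lambda>t. u t * \<tau> t - v t * \<sigma> t)
          = integral \<I> (\<lambda>t. u t * \<tau> t) - integral \<I> (\<lambda>t. v t * \<sigma> t)"
        by (intro Henstock_Kurzweil_Integration.integral_diff integrable_continuous_real
            continuous_on_mult uc vc \<sigma> \<tau>)
      ultimately show ?thesis by simp
    qed
    also have "\<dots> = integral \<I> (\<lambda>s. integral \<I> (\<lambda>t. G s t * \<tau> t) * \<sigma> s)"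
      by (rule Henstock_Kurzweil_Integration.integral_cong) (simp add: v)
    finally show "integral \<I> (\<lambda>s. integral \<I> (\<lambda>t. G t s * \<tau> t) * \<sigma> s)
        = integral \<I> (\<lambda>s. integral \<I> (\<lambda>t. G s t * \<tau> t) * \<sigma> s)" .
  qed fact
  show ?thesis
    using eq_of_integral_against_continuous[OF col[OF \<open>s \<in> \<I>\<close>] row[OF \<open>s \<in> \<I>\<close>] transposed \<open>t \<in> \<I>\<close>]
    by simp
qed

text \<open>
  The reproducing property says that \<open>G 0\<close> and \<open>r\<close> have the same integrals against all
  right-hand sides; symmetry moves the point \<open>0\<close> to the second argument.
\<close>

lemma periodic_greens_function_zero:
  assumes G: "greens_function a lam X_P G" and r: "is_r4 a lam r" and "t \<in> \<I>"
  shows "G t 0 = r t"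
proof -
  note cont = greens_functionD(1)[OF G]
  have G0: "continuous_on \<I> (G 0)" by (rule continuous_on_row[OF cont]) simp
  have rc: "continuous_on \<I> r" using r by (simp add: is_r4_def W21_def)
  have "G 0 t = r t"
  proof (rule eq_of_integral_against_continuous[OF G0 rc _ \<open>t \<in> \<I>\<close>])
    fix \<tau> :: "real \<Rightarrow> real" assume \<tau>: "continuous_on \<I> \<tau>"
    define u where "u t = (\<integral>s. G t s * \<tau> s \<partial>lebesgue_on \<I>)" for t
    have "u \<in> X_P" "solves a lam \<tau> u"
      using greens_functionD(2,3)[OF G continuous_on_\<I>_L1[OF \<tau>]] by (auto simp: u_def[abs_def])
    then have "integral \<I> (\<lambda>s. r s * \<tau> s) = u 0"
      using is_r4_reproducing[OF r] integral_unique by blast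
    also have "u 0 = integral \<I> (\<lambda>s. G 0 s * \<tau> s)"
      unfolding u_def by (rule integral_lebesgue_on_continuous[OF G0 \<tau>])
    finally show "integral \<I> (\<lambda>s. G 0 s * \<tau> s) = integral \<I> (\<lambda>s. r s * \<tau> s)" ..
  qed
  then show ?thesis
    using periodic_greens_function_symmetric[OF G \<open>t \<in> \<I>\<close>, of 0] by simp
qed

section \<open>From the periodic to the Dirichlet problem\<close>

text \<open>
  A Dirichlet solution \<open>w\<close> of the homogeneous equation is periodic up to a jump of its derivative,
  and subtracting the matching multiple of \<open>r\<close> removes that jump. By nonresonance \<open>w\<close> is then a
  multiple of \<open>r\<close>, and \<open>r 1 \<noteq> 0\<close> forces the multiple to be \<open>0\<close>.
\<close>

lemma dirichlet_nonresonant: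
  assumes nonres: "nonresonant a lam X_P" and r: "is_r4 a lam r" "r 1 \<noteq> 0"
  shows "nonresonant a lam X_D"
  unfolding nonresonant_def
proof (intro ballI impI)
  fix w t assume w: "w \<in> X_D" "solves a lam (\<lambda>t. 0) w" and "t \<in> \<I>"
  have w': "w \<in> W21" "w 0 = 0" "w 1 = 0" using w by (auto simp: X_D_def)
  have r': "r \<in> W21" "solves a lam (\<lambda>t. 0) r" "r 0 = r 1" "D\<^sub>I r 0 = D\<^sub>I r 1 + 1"
    using r by (auto simp: is_r4_def algebra_simps)
  define c where "c = D\<^sub>I w 0 - D\<^sub>I w 1"
  define p where "p t = w t + (- c) * r t" for t
  have "p \<in> W21" by (rule W21_add_scaled[OF w'(1) r'(1)]) (rule p_def)
  moreover have Dp: "D\<^sub>I p t = D\<^sub>I w t + (- c) * D\<^sub>I r t" if "t \<in> \<I>" for t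
    by (rule D\<^sub>I_add_scaled[OF w'(1) r'(1) _ that]) (rule p_def)
  moreover have "D\<^sub>I p 0 = D\<^sub>I p 1"
    using Dp[of 0] Dp[of 1] r'(4) by (simp add: c_def algebra_simps)
  ultimately have "p \<in> X_P"
    using w' r' by (simp add: X_P_def p_def)
  moreover have "solves a lam (\<lambda>t. 0 + (- c) * 0) p"
    by (rule solves_add_scaled[OF w'(1) r'(1) w(2) r'(2)]) (rule p_def)
  ultimately have p: "\<forall>t\<in>\<I>. p t = 0"
    using nonres unfolding nonresonant_def by simp
  then have "c = 0" using w' r by (auto simp: p_def)
  then show "w t = 0" using p \<open>t \<in> \<I>\<close> by (simp add: p_def)
qed

text \<open>
  The periodic solution \<open>v\<close> takes the same value at both ends, and so does the homogeneous solution
  \<open>r\<close>; hence \<open>v - (v 1 / r 1) r\<close> vanishes at both ends.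
\<close>

lemma dirichlet_greens_function:
  assumes nonres: "nonresonant a lam X_P" and G: "greens_function a lam X_P G"
    and r: "is_r4 a lam r" "r 1 \<noteq> 0"
  shows "greens_function a lam X_D (\<lambda>t s. G t s - r t / r 1 * G 1 s)"
  unfolding greens_function_def
proof (intro conjI ballI allI)
  note cont = greens_functionD(1)[OF G]
  have r': "r \<in> W21" "solves a lam (\<lambda>t. 0) r" "r 0 = r 1"
    using r by (auto simp: is_r4_def)
  have rc: "continuous_on \<I> r" using r' by (simp add: W21_def)
  have G1: "continuous_on \<I> (G 1)" by (rule continuous_on_row[OF cont]) simp
  have "continuous_on (\<I> \<times> \<I>) (\<lambda>z. (\<lambda>(t, s). G t s) z - r (fst z) / r 1 * G 1 (snd z))"
    by (intro continuous_intros cont continuous_on_compose2[OF rc] continuous_on_compose2[OF G1])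
      (use r in auto)
  then show "continuous_on (\<I> \<times> \<I>) (\<lambda>(t, s). G t s - r t / r 1 * G 1 s)"
    by (simp add: case_prod_unfold)
  fix \<sigma> u :: "real \<Rightarrow> real" assume \<sigma>: "\<sigma> \<in> L1"
  define v where "v t = (\<integral>s. G t s * \<sigma> s \<partial>lebesgue_on \<I>)" for t
  define c where "c = - (v 1 / r 1)"
  define y where "y t = v t + c * r t" for t
  have v: "v \<in> X_P" "solves a lam \<sigma> v"
    using greens_functionD(2,3)[OF G \<sigma>] by (auto simp: v_def[abs_def])
  have v': "v \<in> W21" "v 0 = v 1" using v by (auto simp: X_P_def)
  have y: "y \<in> W21" by (rule W21_add_scaled[OF v'(1) r'(1)]) (rule y_def)
  have y01: "y 0 = 0" "y 1 = 0" using v' r' r by (auto simp: y_def c_def)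
  have ys: "solves a lam \<sigma> y"
    using solves_add_scaled[OF v'(1) r'(1) v(2) r'(2), of y c] by (simp add: y_def)
  have int: "(\<integral>s. (G t s - r t / r 1 * G 1 s) * \<sigma> s \<partial>lebesgue_on \<I>) = y t" if "t \<in> \<I>" for t
  proof -
    note i = integrable_continuous_mult_L1[OF continuous_on_row[OF cont that] \<sigma>]
      integrable_continuous_mult_L1[OF G1 \<sigma>]
    have "(\<integral>s. (G t s - r t / r 1 * G 1 s) * \<sigma> s \<partial>lebesgue_on \<I>)
        = (\<integral>s. G t s * \<sigma> s - r t / r 1 * (G 1 s * \<sigma> s) \<partial>lebesgue_on \<I>)"
      by (simp add: algebra_simps)
    also have "\<dots> = v t - r t / r 1 * v 1"
      using i by (simp add: v_def del: times_divide_eq_left)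
    finally show ?thesis by (simp add: y_def c_def)
  qed
  have "u \<in> X_D \<and> solves a lam \<sigma> u \<longleftrightarrow> (\<forall>t\<in>\<I>. u t = y t)"
  proof
    assume u: "u \<in> X_D \<and> solves a lam \<sigma> u"
    define w where "w t = u t + (- 1) * y t" for t
    have u': "u \<in> W21" "u 0 = 0" "u 1 = 0" "solves a lam \<sigma> u" using u by (auto simp: X_D_def)
    have "w \<in> W21" by (rule W21_add_scaled[OF u'(1) y]) (rule w_def)
    then have "w \<in> X_D" using u' y01 by (simp add: X_D_def w_def)
    moreover have "solves a lam (\<lambda>t. \<sigma> t + (- 1) * \<sigma> t) w"
      by (rule solves_add_scaled[OF u'(1) y u'(4) ys]) (rule w_def)
    ultimately show "\<forall>t\<in>\<I>. u t = y t"
      using dirichlet_nonresonant[OF nonres r] unfolding nonresonant_def by (force simp: w_def)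
  next
    assume uy: "\<forall>t\<in>\<I>. u t = y t"
    have "u \<in> W21" by (rule W21_add_scaled[OF y y, of _ 0]) (use uy in simp)
    moreover have "solves a lam (\<lambda>t. \<sigma> t + 0 * \<sigma> t) u"
      by (rule solves_add_scaled[OF y y ys ys]) (use uy in simp)
    ultimately show "u \<in> X_D \<and> solves a lam \<sigma> u"
      using uy y01 by (simp add: X_D_def)
  qed
  then show "u \<in> X_D \<and> solves a lam \<sigma> u \<longleftrightarrow>
      (\<forall>t\<in>\<I>. u t = (\<integral>s. (G t s - r t / r 1 * G 1 s) * \<sigma> s \<partial>lebesgue_on \<I>))"
    using int by simp
qed

theorem theorem4p12:
  fixes a :: "real \<Rightarrow> real" and lam :: real
    and r4 :: "real \<Rightarrow> real" and G_P :: "real \<Rightarrow> real \<Rightarrow> real"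
  assumes "a \<in> L1"
    and "nonresonant a lam X_P"
    and "greens_function a lam X_P G_P"
    and "is_r4 a lam r4"
    and "r4 1 \<noteq> 0"
  shows "G_P 1 0 \<noteq> 0 \<and>
    (\<exists>G_D. greens_function a lam X_D G_D) \<and>
    (\<forall>G_D. greens_function a lam X_D G_D \<longrightarrow>
      (\<forall>t\<in>\<I>. \<forall>s\<in>\<I>.
        G_D t s = G_P t s - r4 t / r4 1 * G_P 1 s \<and>
        G_P t s - r4 t / r4 1 * G_P 1 s = G_P t s - G_P t 0 / G_P 1 0 * G_P 1 s))"
proof (intro conjI allI impI ballI)
  note D = dirichlet_greens_function[OF assms(2-5)]
  note zero = periodic_greens_function_zero[OF assms(3,4)]
  show "G_P 1 0 \<noteq> 0" using zero[of 1] assms(5) by simp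
  show "\<exists>G_D. greens_function a lam X_D G_D" using D by blast
  fix G_D and t s :: real assume "greens_function a lam X_D G_D" "t \<in> \<I>" "s \<in> \<I>"
  then show "G_D t s = G_P t s - r4 t / r4 1 * G_P 1 s"
    using greens_function_unique[OF _ D] by simp
  show "G_P t s - r4 t / r4 1 * G_P 1 s = G_P t s - G_P t 0 / G_P 1 0 * G_P 1 s"
    using zero[OF \<open>t \<in> \<I>\<close>] zero[of 1] by simp
qed

end
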